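(* Let $(X,\tau_1,\tau_2)$ be a $d$-second countable and $p$-normal bitopological space such that $X=\bigcup_{k=1}^\infty F_k$ for a sequence $F_1,F_2,\ldots$ of $p$-closed subsets of $X$, where for each $k\ge 1$ the set $F_k$ (with its bitopological subspace structure) is $p$-WS-supernormal in $X$ and $p\text{-}\mathrm{ind}\,F_k=0$. Then $p\text{-}\mathrm{Ind}\,X=0$.
   Context: A bitopological space $(X,\tau_1,\tau_2)$ is a set $X$ with two topologies. Always $i,j\in\{1,2\}$, $i\ne j$. "$i$-open", "$i$-closed" refer to $\tau_i$; $\mathrm{co}\,\tau_i$ is the family of $\tau_i$-closed sets. A subset $Y\subset X$ is regarded as a bitopological subspace $(Y,\tau_1',\tau_2')$ with the induced topologies. $d$-second countable: both $\tau_1$ and $\tau_2$ are second countable. $p$-closed: a set $B\subset X$ is $p$-closed if $B=B_1\cap B_2$ with $B_1\in\mathrm{co}\,\tau_1$, $B_2\in\mathrm{co}\,\tau_2$. $p$-normal: for every pair of disjoint sets $A,B$ in $X$ with $A$ 1-closed and $B$ 2-closed there are a 2-open set $U$ and a 1-open set $V$ such that $A\subset U$, $B\subset V$, $U\cap V=\varnothing$. A subspace $(Y,\tau_1',\tau_2')$ of $(X,\tau_1,\tau_2)$ is $(i,j)$-WS-supernormal in $X$ if for each pair of disjoint sets $A\in\mathrm{co}\,\tau_i'$, $B\in\mathrm{co}\,\tau_j$ there are disjoint sets $U\in\tau_j'$, $V\in\tau_i$ such that $A\subset U$ and $B\subset V$. It is $p$-WS-supernormal in $X$ if it is both $(1,2)$-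 and $(2,1)$-WS-supernormal in $X$. $p\text{-}\mathrm{ind}\,X=0$ means: $\tau_1$ has a base consisting of 2-closed sets and $\tau_2$ has a base consisting of 1-closed sets. $p\text{-}\mathrm{Ind}\,X=0$ means: for every 1-closed set $F$ and every 2-open $U\supset F$ there is $V\in\tau_2\cap\mathrm{co}\,\tau_1$ with $F\subset V\subset U$, and for every 2-closed set $\Phi$ and every 1-open $U\supset\Phi$ there is $V\in\tau_1\cap\mathrm{co}\,\tau_2$ with $\Phi\subset V\subset U$. *)

theory Defs
  imports "HOL-Analysis.Analysis"
begin

text \<open>
  A bitopological space is a pair of abstract topologies on the same underlying set. The
  bitopological subspace on a subset \<open>Y\<close> is the pair \<open>subtopology T1 Y\<close>, \<open>subtopology T2 Y\<close>.
\<close>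

definition bitopological_space :: "'a topology \<Rightarrow> 'a topology \<Rightarrow> bool" where
  "bitopological_space T1 T2 \<longleftrightarrow> topspace T1 = topspace T2"

definition d_second_countable :: "'a topology \<Rightarrow> 'a topology \<Rightarrow> bool" where
  "d_second_countable T1 T2 \<longleftrightarrow> second_countable T1 \<and> second_countable T2"

definition p_closed :: "'a topology \<Rightarrow> 'a topology \<Rightarrow> 'a set \<Rightarrow> bool" where
  "p_closed T1 T2 B \<longleftrightarrow> (\<exists>B1 B2. closedin T1 B1 \<and> closedin T2 B2 \<and> B = B1 \<inter> B2)"

definition p_normal :: "'a topology \<Rightarrow> 'a topology \<Rightarrow> bool" where
  "p_normal T1 T2 \<longleftrightarrow>
    (\<forall>A B. closedin T1 A \<and> closedin T2 B \<and> disjnt A B \<longrightarrow>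
      (\<exists>U V. openin T2 U \<and> openin T1 V \<and> A \<subseteq> U \<and> B \<subseteq> V \<and> disjnt U V))"

text \<open>
  For the \<open>(i,j)\<close> version, \<open>Ti\<close> and \<open>Tj\<close> are the \<open>i\<close>-th and the \<open>j\<close>-th topology. The set \<open>A\<close>
  and its neighbourhood \<open>U\<close> live in the subspace \<open>Y\<close>, whereas \<open>B\<close> and its neighbourhood \<open>V\<close>
  live in the whole space.
\<close>

definition WS_supernormal_in :: "'a topology \<Rightarrow> 'a topology \<Rightarrow> 'a set \<Rightarrow> bool" where
  "WS_supernormal_in Ti Tj Y \<longleftrightarrow>
    (\<forall>A B. closedin (subtopology Ti Y) A \<and> closedin Tj B \<and> disjnt A B \<longrightarrow>
      (\<exists>U V. openin (subtopology Tj Y) U \<and> openin Ti V \<and> A \<subseteq> U \<and> B \<subseteq> V \<and> disjnt U V))"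

definition p_WS_supernormal_in :: "'a topology \<Rightarrow> 'a topology \<Rightarrow> 'a set \<Rightarrow> bool" where
  "p_WS_supernormal_in T1 T2 Y \<longleftrightarrow> WS_supernormal_in T1 T2 Y \<and> WS_supernormal_in T2 T1 Y"

text \<open>
  The equation \<open>openin T = arbitrary union_of (\<lambda>W. W \<in> \<B>)\<close> says that \<open>\<B>\<close> is a base of \<open>T\<close>.
  The two zero-dimensionality predicates below also hold for the empty space.
\<close>

definition p_ind_zero :: "'a topology \<Rightarrow> 'a topology \<Rightarrow> bool" where
  "p_ind_zero T1 T2 \<longleftrightarrow>
    (\<exists>\<B>. openin T1 = arbitrary union_of (\<lambda>W. W \<in> \<B>) \<and> (\<forall>W\<in>\<B>. closedin T2 W)) \<and>
    (\<exists>\<B>. openin T2 = arbitrary union_of (\<lambda>W. W \<in> \<B>) \<and> (\<forall>W\<in>\<B>. closedin T1 W))"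

definition p_Ind_zero :: "'a topology \<Rightarrow> 'a topology \<Rightarrow> bool" where
  "p_Ind_zero T1 T2 \<longleftrightarrow>
    (\<forall>F U. closedin T1 F \<and> openin T2 U \<and> F \<subseteq> U \<longrightarrow>
      (\<exists>V. openin T2 V \<and> closedin T1 V \<and> F \<subseteq> V \<and> V \<subseteq> U)) \<and>
    (\<forall>\<Phi> U. closedin T2 \<Phi> \<and> openin T1 U \<and> \<Phi> \<subseteq> U \<longrightarrow>
      (\<exists>V. openin T1 V \<and> closedin T2 V \<and> \<Phi> \<subseteq> V \<and> V \<subseteq> U))"

end

theory Submission
  imports Defs
begin

text \<open>
  The idea is to separate a disjoint pair of a 1-closed set \<open>A\<close> and a 2-closed set \<open>B\<close> by a
  partition of the space. Inside each \<open>F k\<close> such partitions exist, because zero-dimensionality and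
  the Lindelof property give countable covers by sets that are open in one topology and closed in the
  other, and these covers can be disjointified.
  Let \<open>F k = C \<union> D\<close> extend the traces of \<open>A\<close> and \<open>B\<close>. As \<open>F k\<close> is only p-closed, \<open>C\<close> and \<open>D\<close> need
  not be closed in the space, but WS-supernormality keeps the 1-closure of \<open>C\<close> away from \<open>B\<close> and the
  2-closure of \<open>D\<close> away from \<open>A\<close>, and p-closedness of \<open>F k\<close> keeps the two closures apart. So
  \<open>A\<close> and \<open>B\<close> can be enlarged, by p-normality even to closed neighbourhoods, so as to cover \<open>F k\<close>;
  iterating over \<open>k\<close> gives open sets that partition the space.
\<close>

text \<open>The subspace on \<open>S\<close> is Lindelof, so countably many of the base members
  inside \<open>S\<close> already cover it. Admitting \<open>{}\<close> as a value keeps the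
  enumerated family nonempty even when \<open>S\<close> is empty.\<close>

lemma second_countable_base_union_sequence:
  assumes "second_countable X" and base: "openin X = arbitrary union_of (\<lambda>W. W \<in> \<B>)"
    and S: "openin X S"
  obtains W :: "nat \<Rightarrow> 'a set"
    where "\<And>n. W n \<in> insert {} \<B>" "\<And>n. openin X (W n)" "(\<Union>n. W n) = S"
proof -
  let ?\<U> = "{W \<in> \<B>. W \<subseteq> S}"
  have base_open: "openin X W" if "W \<in> \<B>" for W
    using that by (auto simp: base arbitrary_union_of_alt)
  have "Lindelof_space (subtopology X S)"
    using assms(1) by (simp add: second_countable_imp_Lindelof_space second_countable_subtopology)
  moreover have "S \<subseteq> \<Union>?\<U>"
    using S unfolding base arbitrary_union_of_alt by blast
  moreover have "\<forall>W\<in>?\<U>. openin X W"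
    using base_open by simp
  ultimately obtain \<V> where \<V>: "countable \<V>" "\<V> \<subseteq> ?\<U>" "S \<subseteq> \<Union>\<V>"
    unfolding Lindelof_space_subtopology_subset[OF openin_subset[OF S]] by meson
  show thesis
  proof
    have R: "range (from_nat_into (insert {} \<V>)) = insert {} \<V>"
      using \<V>(1) by (simp add: range_from_nat_into)
    show W: "from_nat_into (insert {} \<V>) n \<in> insert {} \<B>" for n
      using R \<V>(2) by blast
    show "openin X (from_nat_into (insert {} \<V>) n)" for n
      using W[of n] base_open by auto
    show "(\<Union>n. from_nat_into (insert {} \<V>) n) = S"
      using \<V>(2,3) by (auto simp: R)
  qed
qed

text \<open>The complements of \<open>A\<close> and \<open>B\<close> are countable unions of sets
  open in one topology and closed in the other. Subtracting finitely many members of one cover from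
  a member of the other therefore preserves openness.\<close>

lemma p_ind_zero_imp_partition:
  assumes "p_ind_zero T1 T2" "second_countable T1" "second_countable T2"
    and top: "topspace T1 = topspace T2"
    and A: "closedin T1 A" and B: "closedin T2 B" and "disjnt A B"
  obtains C D where "openin T2 C" "openin T1 D" "A \<subseteq> C" "B \<subseteq> D" "disjnt C D"
    "C \<union> D = topspace T1"
proof -
  obtain \<B>1 \<B>2 where
    base1: "openin T1 = arbitrary union_of (\<lambda>W. W \<in> \<B>1)" "\<forall>W\<in>\<B>1. closedin T2 W" and
    base2: "openin T2 = arbitrary union_of (\<lambda>W. W \<in> \<B>2)" "\<forall>W\<in>\<B>2. closedin T1 W"
    using assms(1) unfolding p_ind_zero_def by blast
  obtain W where W: "\<And>n::nat. W n \<in> insert {} \<B>1" "\<And>n. openin T1 (W n)"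
      "(\<Union>n. W n) = topspace T1 - A"
    using second_countable_base_union_sequence[OF assms(2) base1(1)] A by (metis closedin_def)
  obtain G where G: "\<And>n::nat. G n \<in> insert {} \<B>2" "\<And>n. openin T2 (G n)"
      "(\<Union>n. G n) = topspace T1 - B"
    using second_countable_base_union_sequence[OF assms(3) base2(1)] B top by (metis closedin_def)
  have clo: "closedin T2 (W n)" "closedin T1 (G n)" for n
    using W(1)[of n] G(1)[of n] base1(2) base2(2) by auto
  \<comment> \<open>The ranges \<open>{..n}\<close> and \<open>{..<n}\<close> differ on purpose: at
    equal indices \<open>W n\<close> wins over \<open>G n\<close>. A point that first appears at
    stage \<open>n\<close> lies in \<open>V n\<close> if it is in \<open>W n\<close>, and in
    \<open>U n\<close> otherwise.\<close>
  define U where "U n = G n - (\<Union>m\<in>{..n}. W m)" for n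
  define V where "V n = W n - (\<Union>m\<in>{..<n}. G m)" for n
  have UV: "disjnt (U n) (V m)" for n m
    by (cases "m \<le> n") (auto simp: U_def V_def disjnt_iff)
  have cover: "x \<in> (\<Union>n. U n) \<union> (\<Union>n. V n)" if "x \<in> topspace T1" for x
  proof -
    have "\<exists>n. x \<in> W n \<union> G n"
      using that W(3) G(3) \<open>disjnt A B\<close> unfolding disjnt_iff by blast
    then obtain n where n: "x \<in> W n \<union> G n" "\<And>m. m < n \<Longrightarrow> x \<notin> W m \<union> G m"
      using exists_least_iff[of "\<lambda>n. x \<in> W n \<union> G n"] by blast
    then have "x \<in> U n \<union> V n"
      unfolding U_def V_def by (auto simp: le_less)
    then show ?thesis by blast
  qed
  show thesis
  proof
    show U2: "openin T2 (\<Union>n. U n)"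
      unfolding U_def using clo G(2) by (intro openin_Union) (auto intro!: openin_diff closedin_Union)
    show V1: "openin T1 (\<Union>n. V n)"
      unfolding V_def using clo W(2) by (intro openin_Union) (auto intro!: openin_diff closedin_Union)
    have AB: "A \<subseteq> topspace T1" "B \<subseteq> topspace T1"
      using closedin_subset[OF A] closedin_subset[OF B] top by simp_all
    have "x \<notin> V n" if "x \<in> A" for x n
      using that W(3) by (auto simp: V_def)
    then show "A \<subseteq> (\<Union>n. U n)"
      using cover AB(1) by fastforce
    have "x \<notin> U n" if "x \<in> B" for x n
      using that G(3) by (auto simp: U_def)
    then show "B \<subseteq> (\<Union>n. V n)"
      using cover AB(2) by fastforce
    show "disjnt (\<Union>n. U n) (\<Union>n. V n)"
      using UV by (auto simp: disjnt_iff)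
    show "(\<Union>n. U n) \<union> (\<Union>n. V n) = topspace T1"
      using openin_subset[OF U2] openin_subset[OF V1] top
      by (intro equalityI Un_least subsetI[OF cover]) simp_all
  qed
qed

text \<open>p-normality is used twice: first to find a 1-closed neighbourhood of \<open>A\<close>
  that misses \<open>B\<close>, then to separate that neighbourhood from \<open>B\<close>.\<close>

lemma p_normal_closed_neighbourhoods:
  assumes "p_normal T1 T2" and top: "topspace T1 = topspace T2"
    and A: "closedin T1 A" and B: "closedin T2 B" and "disjnt A B"
  obtains A' B' U V where "openin T2 U" "openin T1 V" "closedin T1 A'" "closedin T2 B'"
    "A \<subseteq> U" "U \<subseteq> A'" "B \<subseteq> V" "V \<subseteq> B'" "disjnt A' B'"
proof -
  obtain U W where UW: "openin T2 U" "openin T1 W" "A \<subseteq> U" "B \<subseteq> W" "disjnt U W"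
    using assms unfolding p_normal_def by meson
  let ?A' = "topspace T1 - W"
  have A': "closedin T1 ?A'" "disjnt ?A' B"
    using UW by (auto simp: disjnt_iff)
  then obtain U' V where V: "openin T2 U'" "openin T1 V" "?A' \<subseteq> U'" "B \<subseteq> V" "disjnt U' V"
    using assms(1) B unfolding p_normal_def by meson
  show thesis
  proof
    show "U \<subseteq> ?A'"
      using UW openin_subset[OF UW(1)] top by (auto simp: disjnt_iff)
    show "closedin T2 (topspace T2 - U')" "disjnt ?A' (topspace T2 - U')"
      using V by (auto simp: disjnt_iff)
    show "V \<subseteq> topspace T2 - U'"
      using V openin_subset[OF V(2)] top by (auto simp: disjnt_iff)
  qed (use UW V A' in auto)
qed

text \<open>The neighbourhood of \<open>B\<close> is open in the whole space, not just in
  \<open>Y\<close>, so missing \<open>A\<close> it also misses the closure of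
  \<open>A\<close>.\<close>

lemma WS_supernormal_in_disjnt_closure_of:
  assumes "WS_supernormal_in Ti Tj Y"
    and "closedin (subtopology Ti Y) A" "closedin Tj B" "disjnt A B"
  shows "disjnt (Ti closure_of A) B"
proof -
  obtain U V where "openin Ti V" "A \<subseteq> U" "B \<subseteq> V" "disjnt U V"
    using assms unfolding WS_supernormal_in_def by meson
  moreover then have "V \<inter> Ti closure_of A = {}"
    by (subst openin_Int_closure_of_eq_empty) (auto simp: disjnt_iff)
  ultimately show ?thesis
    by (auto simp: disjnt_iff)
qed

text \<open>The two closures stay inside the two closed factors of \<open>Y\<close>, so a common
  point would lie in \<open>Y\<close>, where the closures trace out just \<open>C\<close> and
  \<open>D\<close>.\<close>

lemma p_closed_disjnt_closure_of:
  assumes "p_closed T1 T2 Y" "closedin (subtopology T1 Y) C" "closedin (subtopology T2 Y) D"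
    and "disjnt C D"
  shows "disjnt (T1 closure_of C) (T2 closure_of D)"
proof -
  obtain Y1 Y2 where Y: "closedin T1 Y1" "closedin T2 Y2" "Y = Y1 \<inter> Y2"
    using assms(1) unfolding p_closed_def by blast
  have CD: "C \<subseteq> Y" "D \<subseteq> Y"
    using assms(2,3) closedin_subset by fastforce+
  then have "T1 closure_of C \<subseteq> Y1" "T2 closure_of D \<subseteq> Y2"
    using Y closure_of_minimal[of C Y1 T1] closure_of_minimal[of D Y2 T2] by auto
  then have "T1 closure_of C \<inter> T2 closure_of D \<subseteq> Y"
    using Y by blast
  moreover have "Y \<inter> T1 closure_of C = C" "Y \<inter> T2 closure_of D = D"
    using closure_of_closedin[OF assms(2)] closure_of_closedin[OF assms(3)] CD
    by (simp_all add: closure_of_subtopology Int_absorb1)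
  ultimately show ?thesis
    using assms(4) by (auto simp: disjnt_iff)
qed

text \<open>This is one round of the iteration: the pair \<open>A'\<close>, \<open>B'\<close> is
  again of the kind assumed of \<open>A\<close>, \<open>B\<close>, and the open sets in between
  cover \<open>Y\<close>.\<close>

lemma p_normal_neighbourhoods_covering_subspace:
  assumes top: "topspace T1 = topspace T2"
    and "second_countable T1" "second_countable T2" "p_normal T1 T2"
    and Y: "p_closed T1 T2 Y" "p_WS_supernormal_in T1 T2 Y"
      "p_ind_zero (subtopology T1 Y) (subtopology T2 Y)"
    and A: "closedin T1 A" and B: "closedin T2 B" and AB: "disjnt A B"
  obtains A' B' U V where "openin T2 U" "openin T1 V" "closedin T1 A'" "closedin T2 B'"
    "A \<subseteq> U" "U \<subseteq> A'" "B \<subseteq> V" "V \<subseteq> B'" "disjnt A' B'" "Y \<subseteq> U \<union> V"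
proof -
  have topY: "topspace (subtopology T1 Y) = Y" "topspace (subtopology T2 Y) = Y"
    using Y(1) closedin_subset top unfolding p_closed_def by fastforce+
  obtain C D where CD: "openin (subtopology T2 Y) C" "openin (subtopology T1 Y) D"
    "A \<inter> Y \<subseteq> C" "B \<inter> Y \<subseteq> D" "disjnt C D" "C \<union> D = Y"
  proof (rule p_ind_zero_imp_partition[OF Y(3)])
    show "closedin (subtopology T1 Y) (A \<inter> Y)" "closedin (subtopology T2 Y) (B \<inter> Y)"
      using A B by (auto simp: closedin_subtopology)
    show "disjnt (A \<inter> Y) (B \<inter> Y)"
      using AB by (auto simp: disjnt_iff)
  qed (use assms topY in \<open>simp_all add: second_countable_subtopology\<close>)
  \<comment> \<open>Complementation in \<open>Y\<close> swaps the roles: openness of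
    \<open>D\<close> makes \<open>C\<close> 1-closed in \<open>Y\<close>, and openness of
    \<open>C\<close> makes \<open>D\<close> 2-closed in \<open>Y\<close>.\<close>
  have eqs: "C = Y - D" "D = Y - C"
    using CD(5,6) by (auto simp: disjnt_iff)
  have C1: "closedin (subtopology T1 Y) C"
    using closedin_diff[OF closedin_topspace CD(2)] unfolding topY eqs(1)[symmetric] .
  have D2: "closedin (subtopology T2 Y) D"
    using closedin_diff[OF closedin_topspace CD(1)] unfolding topY eqs(2)[symmetric] .
  let ?A = "A \<union> T1 closure_of C" and ?B = "B \<union> T2 closure_of D"
  have "disjnt C B" "disjnt D A"
    using CD(3-6) by (auto simp: disjnt_iff)
  then have "disjnt (T1 closure_of C) B" "disjnt (T2 closure_of D) A"
    using WS_supernormal_in_disjnt_closure_of C1 D2 A B Y(2) unfolding p_WS_supernormal_in_def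
    by metis+
  then have disj: "disjnt ?A ?B"
    using AB p_closed_disjnt_closure_of[OF Y(1) C1 D2 CD(5)] by (auto simp: disjnt_iff)
  have clo: "closedin T1 ?A" "closedin T2 ?B"
    using A B by (auto intro: closedin_Un)
  obtain A' B' U V where UV: "openin T2 U" "openin T1 V" "closedin T1 A'" "closedin T2 B'"
    "?A \<subseteq> U" "U \<subseteq> A'" "?B \<subseteq> V" "V \<subseteq> B'" "disjnt A' B'"
    by (rule p_normal_closed_neighbourhoods[OF assms(4) top clo disj])
  have "C \<subseteq> T1 closure_of C" "D \<subseteq> T2 closure_of D"
    using closure_of_subset C1 D2 closedin_subset topspace_subtopology by (metis le_inf_iff)+
  then have "Y \<subseteq> U \<union> V"
    using UV(5,7) CD(6) by blast
  then show thesis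
    using that UV by blast
qed

text \<open>Each part of a partition is the complement of the other, hence closed in the other
  topology. The partition is applied to a closed set and the complement of its given
  neighbourhood.\<close>

lemma partition_imp_p_Ind_zero:
  assumes top: "topspace T1 = topspace T2"
    and part: "\<And>A B. closedin T1 A \<Longrightarrow> closedin T2 B \<Longrightarrow> disjnt A B \<Longrightarrow>
      \<exists>U V. openin T2 U \<and> openin T1 V \<and> A \<subseteq> U \<and> B \<subseteq> V \<and> disjnt U V \<and> U \<union> V = topspace T1"
  shows "p_Ind_zero T1 T2"
proof -
  have part': "\<exists>U V. openin T2 U \<and> closedin T1 U \<and> openin T1 V \<and> closedin T2 V \<and>
      A \<subseteq> U \<and> B \<subseteq> V \<and> disjnt U V"
    if AB: "closedin T1 A" "closedin T2 B" "disjnt A B" for A B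
  proof -
    obtain U V where UV: "openin T2 U" "openin T1 V" "A \<subseteq> U" "B \<subseteq> V" "disjnt U V"
        "U \<union> V = topspace T1"
      using part[OF AB] by blast
    then have eqs: "topspace T1 - V = U" "topspace T2 - U = V"
      using top by (auto simp: disjnt_iff)
    have "closedin T1 U" "closedin T2 V"
      using closedin_diff[OF closedin_topspace UV(2)] closedin_diff[OF closedin_topspace UV(1)]
      unfolding eqs .
    with UV show ?thesis by blast
  qed
  show ?thesis
    unfolding p_Ind_zero_def
  proof (intro conjI allI impI)
    fix F U assume *: "closedin T1 F \<and> openin T2 U \<and> F \<subseteq> U"
    then have "closedin T2 (topspace T2 - U)" "disjnt F (topspace T2 - U)"
      by (auto simp: disjnt_iff)
    then obtain V W where "openin T2 V" "closedin T1 V" "F \<subseteq> V" "topspace T2 - U \<subseteq> W" "disjnt V W"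
      using part' * by meson
    then show "\<exists>V. openin T2 V \<and> closedin T1 V \<and> F \<subseteq> V \<and> V \<subseteq> U"
      using openin_subset[of T2 V] by (intro exI[of _ V]) (auto simp: disjnt_iff)
  next
    fix F U assume *: "closedin T2 F \<and> openin T1 U \<and> F \<subseteq> U"
    then have "closedin T1 (topspace T1 - U)" "disjnt (topspace T1 - U) F"
      by (auto simp: disjnt_iff)
    then obtain W V where "openin T1 V" "closedin T2 V" "F \<subseteq> V" "topspace T1 - U \<subseteq> W" "disjnt W V"
      using part' * by meson
    then show "\<exists>V. openin T1 V \<and> closedin T2 V \<and> F \<subseteq> V \<and> V \<subseteq> U"
      using openin_subset[of T1 V] by (intro exI[of _ V]) (auto simp: disjnt_iff)
  qed
qed

theorem theorem2p23:
  fixes T1 T2 :: "'a topology" and F :: "nat \<Rightarrow> 'a set"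
  assumes "bitopological_space T1 T2"
    and "d_second_countable T1 T2"
    and "p_normal T1 T2"
    and "topspace T1 = (\<Union>k\<in>{1..}. F k)"
    and "\<And>k. k \<ge> 1 \<Longrightarrow> p_closed T1 T2 (F k)"
    and "\<And>k. k \<ge> 1 \<Longrightarrow> p_WS_supernormal_in T1 T2 (F k)"
    and "\<And>k. k \<ge> 1 \<Longrightarrow> p_ind_zero (subtopology T1 (F k)) (subtopology T2 (F k))"
  shows "p_Ind_zero T1 T2"
proof (rule partition_imp_p_Ind_zero)
  show top: "topspace T1 = topspace T2"
    using assms(1) by (simp add: bitopological_space_def)
  fix A B assume AB: "closedin T1 A" "closedin T2 B" "disjnt A B"
  \<comment> \<open>Round \<open>n\<close> treats \<open>F (Suc n)\<close>, since the given sequence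
    starts at index 1.\<close>
  define Q where "Q n p q \<longleftrightarrow> (\<exists>U V. openin T2 U \<and> openin T1 V \<and> fst p \<subseteq> U \<and> U \<subseteq> fst q \<and>
      snd p \<subseteq> V \<and> V \<subseteq> snd q \<and> F (Suc n) \<subseteq> U \<union> V)" for n and p q :: "'a set \<times> 'a set"
  \<comment> \<open>The clause for \<open>n = 0\<close> pins the start of the chosen sequence to
    \<open>(A, B)\<close>.\<close>
  define P where "P n p \<longleftrightarrow> closedin T1 (fst p) \<and> closedin T2 (snd p) \<and> disjnt (fst p) (snd p) \<and>
      (n = 0 \<longrightarrow> p = (A, B))" for n :: nat and p :: "'a set \<times> 'a set"
  have "\<exists>f. \<forall>n. P n (f n) \<and> Q n (f n) (f (Suc n))"
  proof (rule dependent_nat_choice)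
    show "\<exists>p. P 0 p"
      using AB by (auto simp: P_def)
    fix p n assume "P n p"
    then have p: "closedin T1 (fst p)" "closedin T2 (snd p)" "disjnt (fst p) (snd p)"
      by (auto simp: P_def)
    have sc: "second_countable T1" "second_countable T2"
      using assms(2) by (auto simp: d_second_countable_def)
    obtain A' B' U V where "openin T2 U" "openin T1 V" "closedin T1 A'" "closedin T2 B'"
      "fst p \<subseteq> U" "U \<subseteq> A'" "snd p \<subseteq> V" "V \<subseteq> B'" "disjnt A' B'" "F (Suc n) \<subseteq> U \<union> V"
      by (rule p_normal_neighbourhoods_covering_subspace
          [OF top sc assms(3) assms(5-7)[of "Suc n"] p]) auto
    then show "\<exists>q. P (Suc n) q \<and> Q n p q"
      by (intro exI[of _ "(A', B')"]) (auto simp: P_def Q_def)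
  qed
  then obtain f where P: "\<And>n. P n (f n)" and Q: "\<And>n. Q n (f n) (f (Suc n))"
    by blast
  obtain U V where UV: "\<And>n. openin T2 (U n)" "\<And>n. openin T1 (V n)"
    "\<And>n. fst (f n) \<subseteq> U n" "\<And>n. U n \<subseteq> fst (f (Suc n))"
    "\<And>n. snd (f n) \<subseteq> V n" "\<And>n. V n \<subseteq> snd (f (Suc n))" "\<And>n. F (Suc n) \<subseteq> U n \<union> V n"
    using Q unfolding Q_def by metis
  \<comment> \<open>The closed pair \<open>f (Suc n)\<close> sits between the open sets of rounds
    \<open>n\<close> and \<open>Suc n\<close>. Monotonicity then reduces disjointness of
    \<open>U m\<close> and \<open>V n\<close> to the common index \<open>max m n\<close>.\<close>
  have "incseq U" "incseq V"
    using UV(3)[of "Suc _"] UV(4) UV(5)[of "Suc _"] UV(6) by (meson incseq_SucI subset_trans)+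
  moreover have "disjnt (U n) (V n)" for n
    using P[of "Suc n"] UV(4,6)[of n] unfolding P_def disjnt_iff by blast
  ultimately have disj: "disjnt (U m) (V n)" for m n
    using monoD[of U m "max m n"] monoD[of V n "max m n"] unfolding disjnt_iff
    by (meson max.cobounded1 max.cobounded2 subsetD)
  show "\<exists>U V. openin T2 U \<and> openin T1 V \<and> A \<subseteq> U \<and> B \<subseteq> V \<and> disjnt U V \<and> U \<union> V = topspace T1"
  proof (intro exI conjI)
    show U2: "openin T2 (\<Union>n. U n)" and V1: "openin T1 (\<Union>n. V n)"
      using UV(1,2) by auto
    show "A \<subseteq> (\<Union>n. U n)" "B \<subseteq> (\<Union>n. V n)"
      using P[of 0] UV(3,5)[of 0] unfolding P_def by auto
    show "disjnt (\<Union>n. U n) (\<Union>n. V n)"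
      using disj by (auto simp: disjnt_iff)
    have "F k \<subseteq> (\<Union>n. U n) \<union> (\<Union>n. V n)" if "k \<ge> 1" for k
      using UV(7)[of "k - 1"] that by auto
    then have "topspace T1 \<subseteq> (\<Union>n. U n) \<union> (\<Union>n. V n)"
      unfolding assms(4) by (intro UN_least) simp
    then show "(\<Union>n. U n) \<union> (\<Union>n. V n) = topspace T1"
      using openin_subset[OF U2] openin_subset[OF V1] top by (intro equalityI Un_least) simp_all
  qed
qed

end
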